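(* Regard two permutations as equivalent if they are Knuth-equivalent, and let $\mathbf p=231$ be the classical pattern. Then for every $n\ge1$, $\widetilde{\mathfrak A}_n(231)$ is the set of permutations in $\mathfrak S_n$ whose insertion tableau is hook-shaped and filled in trivially, and $|\widetilde{\mathfrak A}_n(231)|=2^{n-1}$.
   Context: An elementary Knuth-transformation on a permutation (in one-line notation) applies to three consecutive letters one of the replacements $yzx\mapsto yxz$ if $x<y\le z$, or $xzy\mapsto zxy$ if $x\le y<z$, or one of their inverses. Two permutations are Knuth-equivalent if one can be obtained from the other by a sequence of elementary Knuth-transformations; equivalently, they have the same insertion tableau $P(\pi)$ under the Robinson–Schensted(–Knuth) row insertion. A permutation avoids the classical pattern $231$ if it has no subsequence (of not necessarily adjacent letters) in the same relative order as $231$. $\widetilde{\mathfrak A}_n(\mathbf p)$ is the set of $\pi\in\mathfrak S_n$ such that $\pi$ and every permutation equivalent to $\pi$ avoids $\mathbf p$. A tableau is hook-shaped if its shape is $(k,1,1,\dots,1)$ (a single row and a single column are allowed); it is filled in trivially if its first row is $1,2,\dots,k$ and the remaining boxes of the first column are $k+1,\dots,n$ from top to bottom. *)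

theory Defs
  imports "HOL-Combinatorics.Multiset_Permutations" "HOL-Library.Sublist"
begin

text \<open>
  A permutation in \<open>S\<^sub>n\<close> is represented by its one-line notation, i.e. by a member of
  \<^term>\<open>permutations_of_set {1..n}\<close>.
\<close>

inductive knuth_step :: "'a::linorder list \<Rightarrow> 'a list \<Rightarrow> bool" where
  "x < y \<Longrightarrow> y \<le> z \<Longrightarrow> knuth_step (u @ [y, z, x] @ v) (u @ [y, x, z] @ v)"
| "x \<le> y \<Longrightarrow> y < z \<Longrightarrow> knuth_step (u @ [x, z, y] @ v) (u @ [z, x, y] @ v)"

definition knuth_equiv :: "'a::linorder list \<Rightarrow> 'a list \<Rightarrow> bool" where
  "knuth_equiv = equivclp knuth_step"

definition order_isomorphic :: "'a::linorder list \<Rightarrow> 'b::linorder list \<Rightarrow> bool" where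
  "order_isomorphic xs ys \<longleftrightarrow>
     length xs = length ys \<and>
     (\<forall>i < length xs. \<forall>j < length xs. xs ! i < xs ! j \<longleftrightarrow> ys ! i < ys ! j)"

definition avoids :: "'a::linorder list \<Rightarrow> 'b::linorder list \<Rightarrow> bool" where
  "avoids w p \<longleftrightarrow> \<not> (\<exists>s. subseq s w \<and> order_isomorphic s p)"

definition equiv_avoiders :: "(nat list \<Rightarrow> nat list \<Rightarrow> bool) \<Rightarrow> nat \<Rightarrow> nat list \<Rightarrow> nat list set" where
  "equiv_avoiders R n p =
     {w \<in> permutations_of_set {1..n}.
        avoids w p \<and> (\<forall>w' \<in> permutations_of_set {1..n}. R w w' \<longrightarrow> avoids w' p)}"

text \<open>
  A tableau is the list of its rows, from top to bottom. Inserting into a row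
  returns the new row together with the bumped entry, if there is one.
\<close>

fun row_insert :: "'a::linorder list \<Rightarrow> 'a \<Rightarrow> 'a list \<times> 'a option" where
  "row_insert [] x = ([x], None)"
| "row_insert (y # ys) x =
     (if x < y then (x # ys, Some y)
      else (case row_insert ys x of (zs, b) \<Rightarrow> (y # zs, b)))"

fun tableau_insert :: "'a::linorder list list \<Rightarrow> 'a \<Rightarrow> 'a list list" where
  "tableau_insert [] x = [[x]]"
| "tableau_insert (r # rs) x =
     (case row_insert r x of
        (r', None) \<Rightarrow> r' # rs
      | (r', Some y) \<Rightarrow> r' # tableau_insert rs y)"

definition insertion_tableau :: "'a::linorder list \<Rightarrow> 'a list list" where
  "insertion_tableau w = foldl tableau_insert [] w"

definition hook_shaped :: "'a list list \<Rightarrow> bool" where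
  "hook_shaped T \<longleftrightarrow> (\<exists>k m. k \<ge> 1 \<and> map length T = k # replicate m 1)"

definition trivially_filled :: "nat \<Rightarrow> nat list list \<Rightarrow> bool" where
  "trivially_filled n T \<longleftrightarrow>
     (\<exists>k. hd T = [1..<k+1] \<and> map hd (tl T) = [k+1..<n+1])"

end

theory Submission
  imports Defs
begin

text \<open>
  Both sets consist of the words in which every letter is the strict minimum or the strict
  maximum of the letters from its position on. Such words contain no 231, and the condition
  survives every elementary Knuth-transformation: the transformations of the first kind never
  apply, those of the second swap a minimum with a maximum. Conversely, a letter that
  is followed by both a smaller and a larger one starts a 231 or a 213, and a 213 can be turned
  into a 231 by Knuth-transformations that reduce the distance between its outer letters. Under
  row insertion, the condition on the last inserted letter says exactly that the trivial filling of a
  hook is maintained, the last letter being the end of the first row. Finally, the condition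
  leaves two choices for each letter but the last.
\<close>

section \<open>Extremal words\<close>

fun extremal :: "'a::linorder list \<Rightarrow> bool" where
  "extremal [] \<longleftrightarrow> True"
| "extremal (x # xs) \<longleftrightarrow> ((\<forall>y \<in> set xs. x < y) \<or> (\<forall>y \<in> set xs. y < x)) \<and> extremal xs"

lemma extremal_subseq: "subseq s w \<Longrightarrow> extremal w \<Longrightarrow> extremal s"
proof (induction rule: list_emb.induct)
  case (list_emb_Cons2 x y xs ys)
  then have "set xs \<subseteq> set ys" by (auto elim: list_emb_set)
  then show ?case using list_emb_Cons2 by auto
qed auto

text \<open>Each letter of \<open>u\<close> is compared only with the set of letters after it, so
  the order inside the suffix does not matter to it. Knuth steps can thus be examined without their
  prefix.\<close>

lemma extremal_append_cong:
  "set v = set v' \<Longrightarrow> extremal v = extremal v' \<Longrightarrow> extremal (u @ v) = extremal (u @ v')"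
  by (induction u) auto

lemma not_extremal_decomp:
  assumes "distinct w" "\<not> extremal w"
  obtains u b v a c where "w = u @ b # v" "a \<in> set v" "c \<in> set v" "a < b" "b < c"
  using assms
proof (induction w arbitrary: thesis)
  case (Cons x xs)
  show ?case
  proof (cases "extremal xs")
    case True
    with Cons.prems(3) obtain y z where yz: "y \<in> set xs" "\<not> x < y" "z \<in> set xs" "\<not> z < x"
      by auto
    moreover have "y \<noteq> x" "z \<noteq> x" using Cons.prems(2) yz by auto
    ultimately show ?thesis using Cons.prems(1)[of "[]" x xs y z] by auto
  next
    case False
    show ?thesis
    proof (rule Cons.IH)
      fix u b v a c
      assume "xs = u @ b # v" "a \<in> set v" "c \<in> set v" "a < b" "b < c"
      then show thesis using Cons.prems(1)[of "x # u" b v a c] by simp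
    qed (use Cons.prems False in auto)
  qed
qed simp

section \<open>Knuth equivalence and the pattern 231\<close>

lemma mset_knuth_step: "knuth_step w w' \<Longrightarrow> mset w = mset w'"
  by (induction rule: knuth_step.induct) auto

text \<open>In the first replacement \<open>y\<close> precedes both \<open>x < y\<close> and
  \<open>z \<ge> y\<close> in either word, so neither word is extremal. In the second, either order
  forces \<open>x\<close> to be a minimum and \<open>z\<close> a maximum, and the resulting
  conditions coincide.\<close>

lemma extremal_knuth_step: "knuth_step w w' \<Longrightarrow> extremal w = extremal w'"
proof (induction rule: knuth_step.induct)
  case (1 x y z u v)
  then have "\<not> extremal ([y, z, x] @ v)" "\<not> extremal ([y, x, z] @ v)" by auto
  then show ?case by (intro extremal_append_cong) auto
next
  case (2 x y z u v)
  then have "extremal ([x, z, y] @ v) = extremal ([z, x, y] @ v)" by auto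
  then show ?case by (intro extremal_append_cong) auto
qed

lemma knuth_equiv_refl: "knuth_equiv w w"
  by (simp add: knuth_equiv_def)

lemma knuth_equiv_step: "knuth_step w w' \<or> knuth_step w' w \<Longrightarrow> knuth_equiv w' w'' \<Longrightarrow> knuth_equiv w w''"
  unfolding knuth_equiv_def
  by (meson converse_r_into_equivclp equivclp_trans r_into_equivclp)

lemma knuth_equiv_invariant:
  assumes "knuth_equiv w w'" "\<And>v v'. knuth_step v v' \<Longrightarrow> f v = f v'"
  shows "f w = f w'"
  using assms(1) unfolding knuth_equiv_def
proof (induction rule: equivclp_induct)
  case (step y z)
  then show ?case using assms(2) by metis
qed simp

lemma permutations_of_set_knuth_equiv:
  assumes "knuth_equiv w w'"
  shows "w \<in> permutations_of_set A \<longleftrightarrow> w' \<in> permutations_of_set A"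
proof -
  have "mset w = mset w'" by (rule knuth_equiv_invariant[OF assms mset_knuth_step])
  then have "set w = set w'" "distinct w = distinct w'"
    by (rule mset_eq_setD, rule mset_eq_imp_distinct_iff)
  then show ?thesis by (simp add: permutations_of_set_def)
qed

section \<open>Occurrences of 231 in a Knuth class\<close>

lemma avoids_231_iff:
  "avoids w [2, 3, 1 :: nat] \<longleftrightarrow> \<not> (\<exists>a b c. subseq [b, c, a] w \<and> a < b \<and> b < c)"
proof -
  have iso: "order_isomorphic s [2, 3, 1 :: nat] \<longleftrightarrow> (\<exists>a b c. s = [b, c, a] \<and> a < b \<and> b < c)" for s :: "'a list"
  proof
    assume *: "order_isomorphic s [2, 3, 1 :: nat]"
    then have "length s = 3" by (simp add: order_isomorphic_def)
    then obtain b c a where s: "s = [b, c, a]" by (auto simp: numeral_3_eq_3 length_Suc_conv)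
    have "s ! 2 < s ! 0" "s ! 0 < s ! 1"
      using * by (auto simp: order_isomorphic_def)
    then show "\<exists>a b c. s = [b, c, a] \<and> a < b \<and> b < c" using s by auto
  next
    assume "\<exists>a b c. s = [b, c, a] \<and> a < b \<and> b < c"
    then obtain a b c where "s = [b, c, a]" "a < b" "b < c" "a < c" by fastforce
    then show "order_isomorphic s [2, 3, 1 :: nat]"
      by (simp add: order_isomorphic_def All_less_Suc not_less less_imp_le)
  qed
  show ?thesis unfolding avoids_def iso by blast
qed

text \<open>Extremality passes to subsequences, and \<open>[b, c, a]\<close> with
  \<open>a < b < c\<close> violates it at \<open>b\<close>.\<close>

lemma extremal_avoids_231: "extremal w \<Longrightarrow> avoids w [2, 3, 1 :: nat]"
  unfolding avoids_231_iff by (auto dest!: extremal_subseq)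

lemma not_avoids_231I:
  assumes "a < b" "b < c"
  shows "\<not> avoids (u @ b # v @ c # x @ a # y) [2, 3, 1 :: nat]"
proof -
  have "subseq ([] @ [b] @ [] @ [c] @ [] @ [a] @ []) (u @ [b] @ v @ [c] @ x @ [a] @ y)"
    by (intro list_emb_append_mono) auto
  then show ?thesis using assms unfolding avoids_231_iff by auto
qed

text \<open>Induction on the number of letters between the outer letters \<open>b\<close> and
  \<open>c\<close>. The prefix and all three letters of the pattern are generalized, since the
  shorter 213 may use other letters.\<close>

lemma knuth_equiv_213_to_231:
  assumes "distinct (u @ b # as @ c # v)" "b < c" "a \<in> set as" "a < b"
  shows "\<exists>w'. knuth_equiv (u @ b # as @ c # v) w' \<and> \<not> avoids w' [2, 3, 1 :: nat]"
  using assms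
proof (induction "length as" arbitrary: u b as c v a rule: less_induct)
  case less
  show ?case
  proof (cases "\<exists>d \<in> set as. b < d")
    case True
    then obtain d p q where d: "b < d" "as = p @ d # q" by (meson split_list)
    show ?thesis
    proof (cases "a \<in> set p")
      case True
      \<comment> \<open>\<open>b\<close>, \<open>a\<close>, \<open>d\<close> is a 213 with the
        shorter gap \<open>p\<close>.\<close>
      then show ?thesis
        using less.hyps[of p u b d "q @ c # v" a] less.prems d by auto
    next
      case False
      then have "a \<in> set q" using d less.prems by auto
      then obtain q1 q2 where "q = q1 @ a # q2" by (meson split_list)
      then show ?thesis
        using not_avoids_231I[of a b d u p q1 "q2 @ c # v"] d less.prems knuth_equiv_refl by auto
    qed
  next
    case False
    then have small: "\<forall>d \<in> set as. d < b" using less.prems(1) by (force simp: not_less le_less)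
    consider a1 where "as = [a1]" | a1 a2 r where "as = a1 # a2 # r"
      using less.prems(3) by (metis list.exhaust empty_iff list.set(1))
    then show ?thesis
    proof cases
      case 1
      then have a1: "a1 < b" using small by auto
      \<comment> \<open>The first replacement, with \<open>a1\<close>, \<open>b\<close>,
        \<open>c\<close> as \<open>x\<close>, \<open>y\<close>, \<open>z\<close> and read backwards,
        turns the 213 into a 231.\<close>
      have "knuth_step (u @ [b, c, a1] @ v) (u @ [b, a1, c] @ v)"
        using a1 less.prems by (intro knuth_step.intros) auto
      then have "knuth_equiv (u @ b # as @ c # v) (u @ [b, c, a1] @ v)"
        using 1 by (auto intro: knuth_equiv_step knuth_equiv_refl)
      moreover have "\<not> avoids (u @ [b, c, a1] @ v) [2, 3, 1 :: nat]"
        using not_avoids_231I[of a1 b c u "[]" "[]" v] a1 less.prems by auto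
      ultimately show ?thesis by blast
    next
      case 2
      show ?thesis
      proof (cases "a2 < a1")
        case True
        \<comment> \<open>\<open>a1\<close>, \<open>a2\<close>, \<open>c\<close> is a 213 whose gap
          \<open>a2 # r\<close> is shorter; \<open>b\<close> joins the prefix.\<close>
        have "a1 < c" using 2 small less.prems by auto
        then show ?thesis
          using less.hyps[of "a2 # r" "u @ [b]" a1 c v a2] less.prems 2 True by auto
      next
        case False
        then have a12: "a1 < a2" using less.prems 2 by auto
        have a2: "a2 < b" using 2 small by auto
        have "\<exists>w'. knuth_equiv ((u @ [a1]) @ b # (a2 # r) @ c # v) w' \<and> \<not> avoids w' [2, 3, 1 :: nat]"
          using less.hyps[of "a2 # r" "u @ [a1]" b c v a2] less.prems 2 a2 by auto
        \<comment> \<open>As \<open>a1 < a2 < b\<close>, the second replacement read backwards moves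
          \<open>b\<close> past \<open>a1\<close>. The gap loses \<open>a1\<close>, and
          \<open>a2\<close> becomes the small letter.\<close>
        moreover have "knuth_step (u @ [a1, b, a2] @ r @ c # v) (u @ [b, a1, a2] @ r @ c # v)"
          using a12 a2 by (intro knuth_step.intros) auto
        ultimately show ?thesis using 2 by (auto intro: knuth_equiv_step)
      qed
    qed
  qed
qed

lemma not_extremal_knuth_equiv_231:
  assumes "distinct w" "\<not> extremal w"
  shows "\<exists>w'. knuth_equiv w w' \<and> \<not> avoids w' [2, 3, 1 :: nat]"
proof -
  obtain u b v a c where w: "w = u @ b # v" "a \<in> set v" "c \<in> set v" "a < b" "b < c"
    using not_extremal_decomp assms by blast
  obtain p q where v: "v = p @ c # q" using w by (meson split_list)
  show ?thesis
  proof (cases "a \<in> set p")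
    case True
    then show ?thesis using knuth_equiv_213_to_231[of u b p c q a] assms w v by auto
  next
    case False
    then have "a \<in> set q" using w v by auto
    then obtain q1 q2 where "q = q1 @ a # q2" by (meson split_list)
    then show ?thesis
      using not_avoids_231I[of a b c u p q1 q2] w v knuth_equiv_refl by auto
  qed
qed

lemma equiv_avoiders_231_eq:
  "equiv_avoiders knuth_equiv n [2, 3, 1] = {w \<in> permutations_of_set {1..n}. extremal w}"
proof (intro equalityI subsetI)
  fix w assume w: "w \<in> equiv_avoiders knuth_equiv n [2, 3, 1]"
  then have perm: "w \<in> permutations_of_set {1..n}" by (simp add: equiv_avoiders_def)
  have "extremal w"
  proof (rule ccontr)
    assume "\<not> extremal w"
    then obtain w' where "knuth_equiv w w'" "\<not> avoids w' [2, 3, 1 :: nat]"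
      using not_extremal_knuth_equiv_231 perm by (metis permutations_of_setD(2))
    \<comment> \<open>Knuth steps keep the multiset of letters, so \<open>w'\<close> lies in the
      range of the bounded quantifier in \<open>equiv_avoiders\<close>.\<close>
    then show False
      using w perm permutations_of_set_knuth_equiv by (auto simp: equiv_avoiders_def)
  qed
  then show "w \<in> {w \<in> permutations_of_set {1..n}. extremal w}" using perm by simp
next
  fix w assume "w \<in> {w \<in> permutations_of_set {1..n}. extremal w}"
  then show "w \<in> equiv_avoiders knuth_equiv n [2, 3, 1]"
    using knuth_equiv_invariant[of w _ extremal] extremal_knuth_step extremal_avoids_231
    by (auto simp: equiv_avoiders_def)
qed

section \<open>Insertion tableaux\<close>

text \<open>Insertion extends a word on the right, whereas \<open>extremal\<close> recurses from the
  left. Comparing an earlier letter \<open>j\<close> with \<open>last v\<close> tells whether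
  \<open>j\<close> is a minimum or a maximum, and \<open>x\<close> must lie on the same side of
  \<open>j\<close>.\<close>

lemma extremal_snoc:
  assumes "v \<noteq> []"
  shows "extremal (v @ [x]) \<longleftrightarrow> extremal v \<and> x \<noteq> last v \<and>
           (\<forall>j \<in> set v. (j < last v \<longrightarrow> j < x) \<and> (last v < j \<longrightarrow> x < j))"
  using assms
proof (induction v)
  case (Cons a v)
  show ?case
  proof (cases "v = []")
    case False
    then have "last v \<in> set v" by simp
    then show ?thesis using Cons.IH[OF False] False by (auto dest: order.strict_trans)
  qed auto
qed simp

section \<open>Row insertion in general\<close>

lemma tableau_insert_append:
  assumes "\<forall>z \<in> set r. z \<le> x"
  shows "tableau_insert (r # rs) x = (r @ [x]) # rs"
proof -
  have "row_insert r x = (r @ [x], None)" using assms by (induction r) auto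
  then show ?thesis by simp
qed

lemma tableau_insert_bump:
  assumes "x < y" "\<forall>z \<in> set p. z \<le> x"
  shows "tableau_insert ((p @ y # q) # rs) x = (p @ x # q) # tableau_insert rs y"
proof -
  have "row_insert (p @ y # q) x = (p @ x # q, Some y)" using assms by (induction p) auto
  then show ?thesis by simp
qed

text \<open>Splitting the row at its leftmost entry exceeding \<open>x\<close> replaces the
  recursion of \<open>row_insert\<close> in the inductions over rows below.\<close>

lemma tableau_insert_cases:
  obtains (append) "\<forall>z \<in> set r. z \<le> x" "tableau_insert (r # rs) x = (r @ [x]) # rs"
  | (bump) p y q where "r = p @ y # q" "x < y" "\<forall>z \<in> set p. z \<le> x"
      "tableau_insert (r # rs) x = (p @ x # q) # tableau_insert rs y"
proof (cases "\<forall>z \<in> set r. z \<le> x")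
  case True
  then show ?thesis using append tableau_insert_append by blast
next
  case False
  then have "\<exists>z \<in> set r. x < z" by (auto simp: not_le)
  then obtain p y q where "r = p @ y # q" "x < y" "\<forall>z \<in> set p. \<not> x < z"
    using split_list_first_prop[of r "\<lambda>z. x < z"] by auto
  then show ?thesis using bump[of p y q] tableau_insert_bump[of x y p q rs] by (auto simp: not_less)
qed

lemma insertion_tableau_Nil: "insertion_tableau [] = []"
  by (simp add: insertion_tableau_def)

lemma insertion_tableau_snoc: "insertion_tableau (v @ [x]) = tableau_insert (insertion_tableau v) x"
  by (simp add: insertion_tableau_def)

lemma set_tableau_insert: "set (concat (tableau_insert T x)) = insert x (set (concat T))"
proof (induction T arbitrary: x)
  case (Cons r rs)
  show ?case by (cases r x rs rule: tableau_insert_cases) (auto simp: Cons.IH[simplified])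
qed simp

lemma set_insertion_tableau: "set (concat (insertion_tableau w)) = set w"
  by (induction w rule: rev_induct)
    (simp_all add: insertion_tableau_Nil insertion_tableau_snoc set_tableau_insert del: set_concat)

lemma Nil_notin_tableau_insert: "[] \<notin> set T \<Longrightarrow> [] \<notin> set (tableau_insert T x)"
proof (induction T arbitrary: x)
  case (Cons r rs)
  then show ?case by (cases r x rs rule: tableau_insert_cases) auto
qed simp

lemma Nil_notin_insertion_tableau: "[] \<notin> set (insertion_tableau w)"
  by (induction w rule: rev_induct)
    (simp_all add: insertion_tableau_Nil insertion_tableau_snoc Nil_notin_tableau_insert)

text \<open>What precedes the bumped \<open>y\<close> is at most \<open>x\<close>, and what follows
  it is at least \<open>y\<close>, so \<open>x\<close> fits in its place.\<close>

lemma sorted_tableau_insert: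
  "\<forall>r \<in> set T. sorted r \<Longrightarrow> \<forall>r \<in> set (tableau_insert T x). sorted r"
proof (induction T arbitrary: x)
  case (Cons r rs)
  show ?case
  proof (cases r x rs rule: tableau_insert_cases)
    case append
    then show ?thesis using Cons.prems by (auto simp: sorted_append)
  next
    case (bump p y q)
    then have "sorted (p @ x # q)" using Cons.prems by (auto simp: sorted_append)
    then show ?thesis using Cons bump by auto
  qed
qed simp

lemma sorted_insertion_tableau: "\<forall>r \<in> set (insertion_tableau w). sorted r"
  by (induction w rule: rev_induct)
    (simp_all add: insertion_tableau_Nil insertion_tableau_snoc sorted_tableau_insert)

section \<open>Columns and hooks\<close>

text \<open>Every one-box row bumps its entry into the next row, so the column moves down by one
  box.\<close>

lemma tableau_insert_column:
  "sorted_wrt (<) (y # c) \<Longrightarrow> tableau_insert (map (\<lambda>x. [x]) c) y = map (\<lambda>x. [x]) (y # c)"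
  by (induction c arbitrary: y) auto

text \<open>Appending to a nonempty row would give two boxes, so each insertion must bump the only
  entry of its row.\<close>

lemma tableau_insert_columnD:
  assumes "tableau_insert T y = map (\<lambda>x. [x]) c" "[] \<notin> set T"
  shows "\<exists>c'. c = y # c' \<and> T = map (\<lambda>x. [x]) c'"
  using assms
proof (induction T arbitrary: y c)
  case Nil
  then show ?case by (cases c) auto
next
  case (Cons s T)
  show ?case
  proof (cases s y T rule: tableau_insert_cases)
    case append
    then show ?thesis using Cons.prems by (cases c) auto
  next
    case (bump p z q)
    then obtain c2 where c: "p = []" "q = []" "c = y # c2" "tableau_insert T z = map (\<lambda>x. [x]) c2"
      using Cons.prems by (cases c) (auto simp: append_eq_Cons_conv)
    then show ?thesis using Cons.IH[OF c(4)] Cons.prems(2) bump by auto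
  qed
qed

text \<open>The trivial filling is expressed by the increasing concatenation of the first row and
  the column below it. Unlike the filling by \<open>1, ..., n\<close>, this makes sense for every
  prefix of the word.\<close>

lemma insertion_tableau_extremal:
  assumes "extremal w" "w \<noteq> []"
  shows "\<exists>r c. insertion_tableau w = (r @ [last w]) # map (\<lambda>x. [x]) c \<and> sorted_wrt (<) (r @ last w # c)"
  using assms
proof (induction w rule: rev_induct)
  case (snoc x v)
  show ?case
  proof (cases "v = []")
    case True
    then show ?thesis by (auto simp: insertion_tableau_def)
  next
    case False
    define k where "k = last v"
    have ext: "extremal v" "x \<noteq> k" "\<forall>j \<in> set v. (j < k \<longrightarrow> j < x) \<and> (k < j \<longrightarrow> x < j)"
      using snoc.prems extremal_snoc[OF False, of x] by (auto simp: k_def)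
    obtain r c where T: "insertion_tableau v = (r @ [k]) # map (\<lambda>x. [x]) c"
      and srt: "sorted_wrt (<) (r @ k # c)"
      using snoc.IH[OF ext(1) False] k_def by blast
    have "set v = set (r @ k # c)" using set_insertion_tableau[of v] T by auto
    \<comment> \<open>The entries below \<open>k\<close> are those of \<open>r\<close>, the entries
      above it those of \<open>c\<close>. Hence \<open>x\<close> falls between \<open>r\<close> and
      \<open>c\<close>, on one side of \<open>k\<close>.\<close>
    then have rx: "\<forall>j \<in> set r. j < x" and xc: "\<forall>j \<in> set c. x < j"
      using ext(3) srt by (auto simp: sorted_wrt_append)
    show ?thesis
    proof (cases "x < k")
      case True
      have "tableau_insert (map (\<lambda>x. [x]) c) k = map (\<lambda>x. [x]) (k # c)"
        using srt by (intro tableau_insert_column) (auto simp: sorted_wrt_append)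
      then have "insertion_tableau (v @ [x]) = (r @ [x]) # map (\<lambda>x. [x]) (k # c)"
        using tableau_insert_bump[OF True, of r "[]"] rx
        by (auto simp: insertion_tableau_snoc T less_imp_le)
      moreover have "sorted_wrt (<) (r @ x # k # c)"
        using srt rx xc True by (auto simp: sorted_wrt_append)
      ultimately show ?thesis by (metis last_snoc)
    next
      case False
      then have "k < x" using ext by auto
      then have "insertion_tableau (v @ [x]) = ((r @ [k]) @ [x]) # map (\<lambda>x. [x]) c"
        unfolding insertion_tableau_snoc T using rx by (intro tableau_insert_append) auto
      moreover have "sorted_wrt (<) ((r @ [k]) @ x # c)"
        using srt rx xc \<open>k < x\<close> by (auto simp: sorted_wrt_append)
      ultimately show ?thesis by (metis last_snoc)
    qed
  qed
qed simp

text \<open>The last insertion is undone. The claim on \<open>last w\<close> is carried along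
  because \<open>extremal_snoc\<close> compares the new letter with the last letter of
  \<open>v\<close>.\<close>

lemma extremal_if_insertion_tableau:
  assumes "insertion_tableau w = r # map (\<lambda>x. [x]) c" "sorted_wrt (<) (r @ c)" "r \<noteq> []"
  shows "extremal w \<and> last w = last r"
  using assms
proof (induction w arbitrary: r c rule: rev_induct)
  case (snoc x v)
  show ?case
  proof (cases "insertion_tableau v")
    case Nil
    then have "v = []" using set_insertion_tableau[of v] by auto
    then show ?thesis using snoc.prems by (auto simp: insertion_tableau_def)
  next
    case (Cons s T)
    then have "v \<noteq> []" by (auto simp: insertion_tableau_Nil)
    have nonempty: "s \<noteq> []" "[] \<notin> set T"
      using Nil_notin_insertion_tableau[of v] Cons by auto
    have ins: "tableau_insert (s # T) x = r # map (\<lambda>x. [x]) c"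
      using snoc.prems Cons insertion_tableau_snoc[of v x] by auto
    show ?thesis
    proof (cases s x T rule: tableau_insert_cases)
      case append
      then have rs: "r = s @ [x]" and T: "T = map (\<lambda>x. [x]) c"
        using ins by auto
      have "sorted_wrt (<) (s @ c)" using snoc.prems rs by (auto simp: sorted_wrt_append)
      then have IH: "extremal v" "last v = last s"
        using snoc.IH[of s c] Cons T nonempty by auto
      obtain p k where s: "s = p @ [k]" using nonempty by (metis rev_exhaust)
      have "set v = set (p @ k # c)" using set_insertion_tableau[of v] Cons T s by auto
      moreover have "sorted_wrt (<) (p @ k # x # c)" using snoc.prems(2) rs s by simp
      moreover have "last v = k" using IH s by simp
      \<comment> \<open>\<open>p\<close> holds the letters below \<open>k\<close>, \<open>c\<close>
        those above; \<open>x\<close> exceeds the former and is below the latter.\<close>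
      ultimately have "extremal (v @ [x])"
        unfolding extremal_snoc[OF \<open>v \<noteq> []\<close>] using IH(1)
        by (auto simp: sorted_wrt_append dest: less_asym)
      then show ?thesis using rs by simp
    next
      case pq: (bump p y q)
      have r: "r = p @ x # q" and "tableau_insert T y = map (\<lambda>x. [x]) c"
        using ins pq by auto
      then obtain c' where c': "c = y # c'" "T = map (\<lambda>x. [x]) c'"
        using tableau_insert_columnD nonempty by blast
      \<comment> \<open>Entries to the right of the bumped letter would exceed it, yet it is now in the column.\<close>
      have "q = []"
      proof (rule ccontr)
        assume "q \<noteq> []"
        then obtain z where "z \<in> set q" by fastforce
        moreover have "sorted s" using sorted_insertion_tableau[of v] Cons by auto
        ultimately have "y \<le> z" "z < y"
          using pq snoc.prems(2) r c' by (auto simp: sorted_append sorted_wrt_append)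
        then show False by simp
      qed
      then have srt: "sorted_wrt (<) (p @ x # y # c')" using snoc.prems(2) r c' by simp
      \<comment> \<open>Undoing the bump returns \<open>y\<close> from the top of the column to the
        end of the row, \<open>s = p @ [y]\<close>.\<close>
      then have "sorted_wrt (<) (s @ c')" using pq \<open>q = []\<close> by (auto simp: sorted_wrt_append)
      then have IH: "extremal v" "last v = y"
        using snoc.IH[of s c'] Cons c' nonempty pq \<open>q = []\<close> by auto
      have "set v = set (p @ y # c')"
        using set_insertion_tableau[of v] Cons c' pq \<open>q = []\<close> by auto
      then have "extremal (v @ [x])"
        unfolding extremal_snoc[OF \<open>v \<noteq> []\<close>] using IH srt
        by (auto simp: sorted_wrt_append dest: less_asym)
      then show ?thesis using r \<open>q = []\<close> by simp
    qed
  qed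
qed (simp add: insertion_tableau_Nil)

lemma extremal_iff_trivial_hook:
  assumes w: "w \<in> permutations_of_set {1..n}" and "n \<ge> 1"
  shows "extremal w \<longleftrightarrow> hook_shaped (insertion_tableau w) \<and> trivially_filled n (insertion_tableau w)"
proof
  assume "extremal w"
  moreover have set_w: "set w = {1..n}" using w by (simp add: permutations_of_set_def)
  moreover have "w \<noteq> []" using set_w \<open>n \<ge> 1\<close> by auto
  ultimately obtain r c k where T: "insertion_tableau w = (r @ [k]) # map (\<lambda>x. [x]) c"
    and srt: "sorted_wrt (<) (r @ k # c)"
    using insertion_tableau_extremal by blast
  have set_rkc: "set (r @ k # c) = {1..n}"
    using set_insertion_tableau[of w] T set_w by auto
  have "set (r @ [k]) = {j \<in> set (r @ k # c). j \<le> k}"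
    using srt by (auto simp: sorted_wrt_append intro: less_imp_le)
  \<comment> \<open>Since \<open>k\<close> occurs in the word, \<open>k \<le> n\<close>, and cutting
    \<open>{1..n}\<close> at \<open>k\<close> gives the whole of \<open>{1..k}\<close>.\<close>
  also have "\<dots> = {1..k}" unfolding set_rkc using set_rkc
    by (force dest: equalityD1)
  finally have "set (r @ [k]) = {1..k}" .
  then have r: "r @ [k] = [1..<k+1]"
    using srt by (intro strict_sorted_equal) (auto simp: sorted_wrt_append)
  have "set c = {j \<in> set (r @ k # c). k < j}"
    using srt by (auto simp: sorted_wrt_append dest: less_asym)
  also have "\<dots> = {k+1..n}" unfolding set_rkc by auto
  finally have "set c = {k+1..n}" .
  then have c: "c = [k+1..<n+1]"
    using srt by (intro strict_sorted_equal) (auto simp: sorted_wrt_append)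
  show "hook_shaped (insertion_tableau w) \<and> trivially_filled n (insertion_tableau w)"
  proof
    have "map length (insertion_tableau w) = (length r + 1) # replicate (length c) 1"
      by (simp add: T comp_def map_replicate_const)
    then show "hook_shaped (insertion_tableau w)" unfolding hook_shaped_def by (metis le_add2)
    show "trivially_filled n (insertion_tableau w)"
      unfolding trivially_filled_def by (rule exI[of _ k]) (simp add: T r[simplified] c comp_def)
  qed
next
  assume *: "hook_shaped (insertion_tableau w) \<and> trivially_filled n (insertion_tableau w)"
  then obtain j m where "j \<ge> 1" and len: "map length (insertion_tableau w) = j # replicate m 1"
    unfolding hook_shaped_def by metis
  then obtain r rs where T: "insertion_tableau w = r # rs" and "length r = j"
    and rs: "map length rs = replicate m 1"
    by (auto simp: map_eq_Cons_conv)
  then have r: "r \<noteq> []" using \<open>j \<ge> 1\<close> by auto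
  have "\<forall>s \<in> set rs. length s = 1"
    using rs by (metis in_set_replicate list.set_map imageI)
  \<comment> \<open>One-box rows are determined by their heads, which
    \<open>trivially_filled\<close> prescribes.\<close>
  then have "rs = map (\<lambda>x. [x]) (map hd rs)"
    by (induction rs) (auto simp: length_Suc_conv)
  moreover obtain k where "r = [1..<k+1]" "map hd rs = [k+1..<n+1]"
    using * T unfolding trivially_filled_def by auto
  ultimately show "extremal w"
    using extremal_if_insertion_tableau[of w r "[k+1..<n+1]"] T r
    by (auto simp: sorted_wrt_append)
qed

section \<open>Enumeration\<close>

text \<open>The first letter is \<open>Min A\<close> or \<open>Max A\<close>, and the rest is any
  extremal word on the remaining letters. An arbitrary finite set \<open>A\<close> is used because
  deleting a letter from \<open>{1..n}\<close> need not leave a set of this form.\<close>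

lemma card_extremal_permutations:
  assumes "finite A" "A \<noteq> {}"
  shows "card {w \<in> permutations_of_set A. extremal w} = 2 ^ (card A - 1)"
  using assms
proof (induction "card A" arbitrary: A)
  case (Suc m)
  show ?case
  proof (cases "m = 0")
    case True
    then obtain a where "A = {a}" using Suc by (metis One_nat_def card_1_singletonE)
    moreover have "{w \<in> permutations_of_set {a}. extremal w} = {[a]}" by auto
    ultimately show ?thesis by simp
  next
    case False
    define E where "E = (\<lambda>A::'a set. {w \<in> permutations_of_set A. extremal w})"
    have fin_E: "finite (E B)" for B by (simp add: E_def)
    have rec: "card (E (A - {a})) = 2 ^ (m - 1)" if "a \<in> A" for a
    proof -
      have m: "m = card (A - {a})" using Suc(2,3) that by simp
      then have "A - {a} \<noteq> {}" using False by fastforce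
      then show ?thesis using Suc(1)[OF m] Suc(3) m by (simp add: E_def)
    qed
    have mm: "Min A \<in> A" "Max A \<in> A" using Suc by auto
    have "Min A \<noteq> Max A"
    proof
      assume "Min A = Max A"
      then have "A \<subseteq> {Min A}" using Suc.prems(1) by (metis Max_ge Min_le order.antisym singletonI subsetI)
      then have "card A \<le> card {Min A}" by (intro card_mono) auto
      then show False using Suc(2) False by simp
    qed
    have cons: "x # v \<in> E A \<longleftrightarrow> x \<in> A \<and> v \<in> E (A - {x}) \<and> (x = Min A \<or> x = Max A)" for x v
    proof -
      have "(\<forall>y \<in> A - {x}. x < y) \<longleftrightarrow> x = Min A" "(\<forall>y \<in> A - {x}. y < x) \<longleftrightarrow> x = Max A" if "x \<in> A"
        using that Suc.prems by (auto simp: eq_Min_iff eq_Max_iff order.order_iff_strict)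
      then show ?thesis
        by (auto simp: E_def permutations_of_set_def)
    qed
    have "E A = (#) (Min A) ` E (A - {Min A}) \<union> (#) (Max A) ` E (A - {Max A})"
    proof (intro set_eqI)
      fix w
      have "[] \<notin> E A" using Suc.prems by (auto simp: E_def permutations_of_set_def)
      then show "w \<in> E A \<longleftrightarrow> w \<in> (#) (Min A) ` E (A - {Min A}) \<union> (#) (Max A) ` E (A - {Max A})"
        using mm cons by (cases w) auto
    qed
    moreover have "(#) (Min A) ` E (A - {Min A}) \<inter> (#) (Max A) ` E (A - {Max A}) = {}"
      using \<open>Min A \<noteq> Max A\<close> by auto
    ultimately have "card (E A) = card (E (A - {Min A})) + card (E (A - {Max A}))"
      by (simp add: card_Un_disjoint card_image fin_E)
    \<comment> \<open>The sum of two equal powers \<open>2 ^ (m - 1)\<close> is \<open>2 ^ m\<close>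
      as \<open>m\<close> is positive.\<close>
    also have "\<dots> = 2 ^ m" using rec mm False by (cases m) auto
    finally show ?thesis using Suc(2) by (simp add: E_def flip: Suc(2))
  qed
qed simp

theorem proposition5p9:
  fixes n :: nat
  assumes "n \<ge> 1"
  shows "equiv_avoiders knuth_equiv n [2, 3, 1] =
           {w \<in> permutations_of_set {1..n}.
              hook_shaped (insertion_tableau w) \<and> trivially_filled n (insertion_tableau w)}
       \<and> card (equiv_avoiders knuth_equiv n [2, 3, 1]) = 2 ^ (n - 1)"
proof -
  have "card {w \<in> permutations_of_set {1..n}. extremal w} = 2 ^ (n - 1)"
    using card_extremal_permutations[of "{1..n}"] assms by simp
  moreover have "{w \<in> permutations_of_set {1..n}. extremal w} =
      {w \<in> permutations_of_set {1..n}.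
         hook_shaped (insertion_tableau w) \<and> trivially_filled n (insertion_tableau w)}"
    using extremal_iff_trivial_hook[OF _ assms] by blast
  ultimately show ?thesis unfolding equiv_avoiders_231_eq by simp
qed

end
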